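(* Let $w\ge2$ be an integer. Then \[ \sup_{\epsilon>0}\ \inf_{\vec s\in S_w} G_w(\epsilon,\vec s) \;\ge\; C_w . \]
   Context: $S_w$ is the set of infinite sequences $\vec s=\{s_i, i\ge0\}$ of positive numbers with $\lim_{i\to\infty}s_i=\infty$, $s_0=1$, and $s_{i+w}>s_i$ for all $i\ge0$. For $\epsilon>0$ and $\vec s\in S_w$, $G_w(\epsilon,\vec s) = \epsilon\sum_{i=0}^\infty \frac{s_i+\cdots+s_{i+w-1}}{s_i^{1+\epsilon}}$. Let $r_w>1$ be the unique number with $\frac{r_w^w-1}{(r_w-1)\ln r_w}=\min_{r>1}\frac{r^w-1}{(r-1)\ln r}$, and $C_w = \frac{r_w^w-1}{(r_w-1)\ln r_w}$. *)

theory Defs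
  imports "HOL-Analysis.Analysis"
begin

definition S :: "nat \<Rightarrow> (nat \<Rightarrow> real) set" where
  "S w = {s. (\<forall>i. s i > 0) \<and> filterlim s at_top sequentially \<and> s 0 = 1 \<and> (\<forall>i. s (i + w) > s i)}"

text \<open>The series has positive terms on \<open>S w\<close> and may diverge, so its value is taken in
  \<^typ>\<open>ennreal\<close>.\<close>

definition G :: "nat \<Rightarrow> real \<Rightarrow> (nat \<Rightarrow> real) \<Rightarrow> ennreal" where
  "G w \<epsilon> s = ennreal \<epsilon> * (\<Sum>i. ennreal ((\<Sum>j<w. s (i + j)) / s i powr (1 + \<epsilon>)))"

definition geom_ratio :: "nat \<Rightarrow> real \<Rightarrow> real" where
  "geom_ratio w r = (r ^ w - 1) / ((r - 1) * ln r)"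

definition r_opt :: "nat \<Rightarrow> real" where
  "r_opt w = (THE r. is_arg_min (geom_ratio w) (\<lambda>r. r > 1) r)"

definition C :: "nat \<Rightarrow> real" where
  "C w = geom_ratio w (r_opt w)"

end

theory Submission
  imports Defs "HOL-Real_Asymp.Real_Asymp"
begin

text \<open>Let \<open>r\<close> be the minimiser. Stationarity says \<open>\<Sum>j<w. r^j = ln r * (\<Sum>j<w. j * r^j)\<close>, so that
  \<open>C w = (\<Sum>j<w. j * r^j)\<close>, and the tangent line bound
  \<open>s (i+j) / s i \<ge> r^j * (1 + ln (s (i+j)) - ln (s i) - j * ln r)\<close> sums over \<open>j\<close> to
  \<open>(\<Sum>j<w. s (i+j) / s i) \<ge> (\<Sum>j<w. r^j * (ln (s (i+j)) - ln (s i)))\<close>.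
  By convexity of \<open>a \<mapsto> exp (- \<epsilon> * a)\<close>, multiplying by \<open>\<epsilon> * s i powr - \<epsilon>\<close> bounds the
  \<open>i\<close>-th term of \<open>G w \<epsilon> s\<close> below by \<open>\<Sum>j<w. r^j * (s i powr - \<epsilon> - s (i+j) powr - \<epsilon>)\<close>, which telescopes:
  \<open>G w \<epsilon> s \<ge> (\<Sum>j<w. r^j * (\<Sum>i<j. s i powr - \<epsilon>))\<close>. Either some \<open>s i\<close> with \<open>i < w\<close> exceeds
  \<open>C w / \<epsilon>\<close>, and the zeroth term of the series alone gives \<open>G w \<epsilon> s \<ge> C w\<close>, or
  \<open>G w \<epsilon> s \<ge> C w * (\<epsilon> / C w) powr \<epsilon>\<close>, which tends to \<open>C w\<close> as \<open>\<epsilon> \<rightarrow> 0\<close>.\<close>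

text \<open>The equation says that the derivative of \<open>(\<Sum>j<w. x ^ j) / ln x\<close>
  vanishes at \<open>r\<close>. A root comes from the intermediate value theorem on
  \<open>{1..exp 2}\<close>.\<close>

lemma stationary_point_exists:
  fixes w :: nat
  assumes "w \<ge> 2"
  obtains r :: real where "r > 1" "(\<Sum>j<w. r ^ j) = ln r * (\<Sum>j<w. real j * r ^ j)"
proof -
  define f where "f x = (\<Sum>j<w. x ^ j * (1 - real j * ln x))" for x :: real
  have split: "{..<w} = insert 0 (insert 1 {2..<w})"
    using assms by auto
  \<comment> \<open>At \<open>exp 2\<close> the terms \<open>j = 0\<close> and \<open>j = 1\<close>
    of \<open>f\<close> add up to \<open>1 - exp 2\<close>, which is negative; all later terms carry
    the factor \<open>1 - 2 * j\<close>.\<close>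
  have "1 + 2 \<le> exp (2::real)"
    by (rule exp_ge_add_one_self)
  moreover have "(\<Sum>j\<in>{2..<w}. exp 2 ^ j * (1 - real j * 2)) \<le> 0"
    by (intro sum_nonpos mult_nonneg_nonpos) auto
  ultimately have neg: "f (exp 2) \<le> 0"
    unfolding f_def split by simp
  have pos: "f 1 > 0"
    using assms by (simp add: f_def)
  have "continuous_on {1..exp 2} f"
    unfolding f_def by (intro continuous_intros) auto
  then obtain r where r: "1 \<le> r" "f r = 0"
    using IVT2'[of f "exp 2" 0 1] neg pos by auto
  have "r \<noteq> 1"
    using r pos by auto
  show thesis
  proof (rule that)
    show "r > 1"
      using r \<open>r \<noteq> 1\<close> by simp
    show "(\<Sum>j<w. r ^ j) = ln r * (\<Sum>j<w. real j * r ^ j)"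
      using r(2) by (simp add: f_def algebra_simps sum_subtractf sum_distrib_left)
  qed
qed

text \<open>Tangent line of \<open>exp\<close> at 0, scaled by \<open>r ^ j\<close>; it touches the
  graph only at 0. The strict form is what makes the minimiser unique.\<close>

lemma power_mult_one_plus_ln_less:
  fixes r y :: real
  assumes "r > 0" "y > 0" "y \<noteq> r ^ j"
  shows "r ^ j * (1 + ln y - real j * ln r) < y"
proof -
  define u where "u = ln y - real j * ln r"
  have y: "y = r ^ j * exp u"
    using assms by (simp add: u_def exp_diff exp_of_nat_mult)
  with assms have "u \<noteq> 0"
    by auto
  have "exp u \<noteq> 1 + u"
  proof
    assume "exp u = 1 + u"
    then have "ln (exp u) = exp u - 1"
      unfolding ln_exp by linarith
    then have "exp u = 1"
      by (rule ln_eq_minus_one[OF exp_gt_zero])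
    with \<open>u \<noteq> 0\<close> show False
      by simp
  qed
  then have "1 + u < exp u"
    using exp_ge_add_one_self[of u] by linarith
  then have "r ^ j * (1 + u) < y"
    unfolding y using \<open>r > 0\<close> by simp
  then show ?thesis
    by (simp add: u_def add_diff_eq)
qed

lemma power_mult_one_plus_ln_le:
  fixes r y :: real
  assumes "r > 0" "y > 0"
  shows "r ^ j * (1 + ln y - real j * ln r) \<le> y"
  using power_mult_one_plus_ln_less[OF assms, of j] assms
  by (cases "y = r ^ j") (auto simp: ln_realpow)

text \<open>The tangent bound with \<open>y = x ^ j\<close>, summed over \<open>j\<close>, shows
  that a stationary point is the strict global minimiser, so the \<open>THE\<close> in
  \<open>r_opt\<close> denotes \<open>r\<close>.\<close>

lemma C_eq_stationary:
  fixes r :: real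
  assumes "w \<ge> 2" "r > 1" and stat: "(\<Sum>j<w. r ^ j) = ln r * (\<Sum>j<w. real j * r ^ j)"
  shows "C w = (\<Sum>j<w. real j * r ^ j)"
proof -
  let ?P = "\<Sum>j<w. real j * r ^ j"
  have ratio: "geom_ratio w x = (\<Sum>j<w. x ^ j) / ln x" if "x > 1" for x
    using that by (simp add: geom_ratio_def geometric_sum)
  have val: "geom_ratio w r = ?P"
    using assms by (simp add: ratio)
  have less: "?P < geom_ratio w x" if "x > 1" "x \<noteq> r" for x
  proof -
    have "(\<Sum>j<w. r ^ j * (1 + ln (x ^ j) - real j * ln r)) < (\<Sum>j<w. x ^ j)"
    proof (rule sum_strict_mono_ex1)
      show "\<forall>j\<in>{..<w}. r ^ j * (1 + ln (x ^ j) - real j * ln r) \<le> x ^ j"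
        using assms that by (intro ballI power_mult_one_plus_ln_le) auto
      \<comment> \<open>Index 0 always gives equality; index 1 is strict because
        \<open>x \<noteq> r\<close>, and it is in range since \<open>w \<ge> 2\<close>.\<close>
      show "\<exists>j\<in>{..<w}. r ^ j * (1 + ln (x ^ j) - real j * ln r) < x ^ j"
        using assms that by (intro bexI[of _ 1] power_mult_one_plus_ln_less) auto
    qed simp
    moreover have "(\<Sum>j<w. r ^ j * (1 + ln (x ^ j) - real j * ln r)) = ln x * ?P"
      using stat that
      by (simp add: ln_realpow algebra_simps sum.distrib sum_subtractf sum_distrib_left)
    ultimately show ?thesis
      using that by (simp add: ratio field_simps)
  qed
  have "r_opt w = r"
    unfolding r_opt_def
  proof (rule the_equality)
    show "is_arg_min (geom_ratio w) (\<lambda>r. r > 1) r"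
      using assms less val by (force simp: is_arg_min_def)
    show "x = r" if "is_arg_min (geom_ratio w) (\<lambda>r. r > 1) x" for x
      using that \<open>r > 1\<close> less[of x] val by (metis is_arg_min_def)
  qed
  with val show ?thesis
    by (simp add: C_def)
qed

lemma powr_minus_diff_le:
  fixes a b \<epsilon> :: real
  assumes "a > 0" "b > 0"
  shows "a powr - \<epsilon> - b powr - \<epsilon> \<le> \<epsilon> * a powr - \<epsilon> * (ln b - ln a)"
proof -
  have "b powr - \<epsilon> = a powr - \<epsilon> * exp (- \<epsilon> * (ln b - ln a))"
    using assms by (simp add: powr_def algebra_simps flip: exp_add)
  moreover have "a powr - \<epsilon> * (1 + - \<epsilon> * (ln b - ln a)) \<le> a powr - \<epsilon> * exp (- \<epsilon> * (ln b - ln a))"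
    by (intro mult_left_mono exp_ge_add_one_self) auto
  ultimately show ?thesis
    by (simp add: algebra_simps)
qed

text \<open>Both sides are the sum of the first \<open>j\<close> values minus that of the
  \<open>j\<close> values from index \<open>N\<close> on. Thus only boundary blocks survive the
  telescoping.\<close>

lemma sum_shift_diff:
  fixes u :: "nat \<Rightarrow> 'a::ab_group_add"
  shows "(\<Sum>i<N. u i - u (i + j)) = (\<Sum>i<j. u i - u (N + i))"
proof (induction N)
  case (Suc N)
  have "(\<Sum>i<j. u (N + i) - u (N + Suc i)) = u N - u (N + j)"
    using sum_lessThan_telescope'[of "\<lambda>i. u (N + i)" j] by simp
  then have "(\<Sum>i<Suc N. u i - u (i + j))
      = (\<Sum>i<j. u i - u (N + i)) + (\<Sum>i<j. u (N + i) - u (N + Suc i))"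
    using Suc by simp
  then show ?case
    by (simp flip: sum.distrib)
qed simp

lemma term_ge:
  fixes s :: "nat \<Rightarrow> real"
  assumes "r > 1" and stat: "(\<Sum>j<w. r ^ j) = ln r * (\<Sum>j<w. real j * r ^ j)"
    and s: "\<And>i. s i > 0" and "\<epsilon> > 0"
  shows "(\<Sum>j<w. r ^ j * (s i powr - \<epsilon> - s (i + j) powr - \<epsilon>))
    \<le> \<epsilon> * ((\<Sum>j<w. s (i + j)) / s i powr (1 + \<epsilon>))"
proof -
  have "(\<Sum>j<w. r ^ j * (s i powr - \<epsilon> - s (i + j) powr - \<epsilon>))
      \<le> (\<Sum>j<w. r ^ j * (\<epsilon> * s i powr - \<epsilon> * (ln (s (i + j)) - ln (s i))))"
    using assms by (intro sum_mono mult_left_mono powr_minus_diff_le) auto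
  \<comment> \<open>By stationarity the weights \<open>r ^ j\<close> annihilate
    \<open>1 - real j * ln r\<close>, so this summand can be inserted to reach the form of the
    tangent bound.\<close>
  also have "\<dots> = \<epsilon> * s i powr - \<epsilon> *
      (\<Sum>j<w. r ^ j * (1 + ln (s (i + j) / s i) - real j * ln r))"
    using stat s[THEN less_imp_neq, THEN not_sym]
    by (simp add: ln_div algebra_simps sum.distrib sum_subtractf sum_distrib_left)
  also have "\<dots> \<le> \<epsilon> * s i powr - \<epsilon> * (\<Sum>j<w. s (i + j) / s i)"
    using assms by (intro mult_left_mono sum_mono power_mult_one_plus_ln_le) auto
  also have "\<dots> = \<epsilon> * ((\<Sum>j<w. s (i + j)) / s i powr (1 + \<epsilon>))"
    using s[of i] by (simp add: powr_add powr_minus field_simps flip: sum_divide_distrib)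
  finally show ?thesis .
qed

lemma G_ge_partial_sum:
  assumes "\<And>i. s i > 0" "\<epsilon> > 0"
  shows "ennreal (\<Sum>i<N. \<epsilon> * ((\<Sum>j<w. s (i + j)) / s i powr (1 + \<epsilon>))) \<le> G w \<epsilon> s"
proof -
  have nonneg: "0 \<le> (\<Sum>j<w. s (i + j)) / s i powr (1 + \<epsilon>)" for i
    using assms by (intro divide_nonneg_nonneg sum_nonneg) (auto simp: less_imp_le)
  have "ennreal (\<Sum>i<N. \<epsilon> * ((\<Sum>j<w. s (i + j)) / s i powr (1 + \<epsilon>)))
      = ennreal \<epsilon> * (\<Sum>i<N. ennreal ((\<Sum>j<w. s (i + j)) / s i powr (1 + \<epsilon>)))"
    unfolding sum_distrib_left[symmetric] using assms nonneg
    by (simp add: sum_nonneg ennreal_mult sum_ennreal del: times_divide_eq_right)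
  also have "\<dots> \<le> G w \<epsilon> s"
    unfolding G_def by (intro mult_left_mono sum_le_suminf) auto
  finally show ?thesis .
qed

lemma G_ge_boundary_sum:
  assumes "r > 1" and stat: "(\<Sum>j<w. r ^ j) = ln r * (\<Sum>j<w. real j * r ^ j)"
    and "s \<in> S w" "\<epsilon> > 0"
  shows "ennreal (\<Sum>j<w. r ^ j * (\<Sum>i<j. s i powr - \<epsilon>)) \<le> G w \<epsilon> s"
proof (rule tendsto_upperbound)
  have s: "\<And>i. s i > 0" and lim: "filterlim s at_top sequentially"
    using assms by (auto simp: S_def)
  \<comment> \<open>Since \<open>s\<close> tends to infinity, the boundary block at \<open>N\<close>
    vanishes in the limit.\<close>
  have "((\<lambda>x::real. x powr - \<epsilon>) \<longlongrightarrow> 0) at_top"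
    using \<open>\<epsilon> > 0\<close> by (intro tendsto_neg_powr filterlim_ident) auto
  then have u: "(\<lambda>i. s i powr - \<epsilon>) \<longlonglongrightarrow> 0"
    using lim by (rule filterlim_compose)
  have "(\<lambda>N. s (N + i) powr - \<epsilon>) \<longlonglongrightarrow> 0" for i
    using LIMSEQ_ignore_initial_segment[OF u] .
  then have "(\<lambda>N. \<Sum>j<w. r ^ j * (\<Sum>i<j. s i powr - \<epsilon> - s (N + i) powr - \<epsilon>))
      \<longlonglongrightarrow> (\<Sum>j<w. r ^ j * (\<Sum>i<j. s i powr - \<epsilon> - 0))"
    by (intro tendsto_intros)
  then show "(\<lambda>N. ennreal (\<Sum>j<w. r ^ j * (\<Sum>i<j. s i powr - \<epsilon> - s (N + i) powr - \<epsilon>)))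
      \<longlonglongrightarrow> ennreal (\<Sum>j<w. r ^ j * (\<Sum>i<j. s i powr - \<epsilon>))"
    by (intro tendsto_ennrealI) simp
  show "\<forall>\<^sub>F N in sequentially.
      ennreal (\<Sum>j<w. r ^ j * (\<Sum>i<j. s i powr - \<epsilon> - s (N + i) powr - \<epsilon>)) \<le> G w \<epsilon> s"
  proof (intro always_eventually allI)
    fix N
    have "(\<Sum>j<w. r ^ j * (\<Sum>i<j. s i powr - \<epsilon> - s (N + i) powr - \<epsilon>))
        = (\<Sum>j<w. \<Sum>i<N. r ^ j * (s i powr - \<epsilon> - s (i + j) powr - \<epsilon>))"
      using sum_shift_diff[of "\<lambda>i. s i powr - \<epsilon>"] by (simp flip: sum_distrib_left)
    also have "\<dots> = (\<Sum>i<N. \<Sum>j<w. r ^ j * (s i powr - \<epsilon> - s (i + j) powr - \<epsilon>))"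
      by (rule sum.swap)
    also have "\<dots> \<le> (\<Sum>i<N. \<epsilon> * ((\<Sum>j<w. s (i + j)) / s i powr (1 + \<epsilon>)))"
      using assms s by (intro sum_mono term_ge) auto
    finally show "ennreal (\<Sum>j<w. r ^ j * (\<Sum>i<j. s i powr - \<epsilon> - s (N + i) powr - \<epsilon>)) \<le> G w \<epsilon> s"
      using G_ge_partial_sum[of s \<epsilon> w N] s \<open>\<epsilon> > 0\<close> by (meson ennreal_leI order_trans)
  qed
qed simp

lemma G_ge:
  assumes "r > 1" and stat: "(\<Sum>j<w. r ^ j) = ln r * (\<Sum>j<w. real j * r ^ j)"
    and P: "P = (\<Sum>j<w. real j * r ^ j)" "P > 0"
    and "s \<in> S w" and \<epsilon>: "\<epsilon> > 0" "\<epsilon> \<le> P"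
  shows "ennreal (P * (\<epsilon> / P) powr \<epsilon>) \<le> G w \<epsilon> s"
proof (cases "\<exists>i<w. s i > P / \<epsilon>")
  case True
  then obtain i where i: "i < w" "s i > P / \<epsilon>"
    by blast
  have s: "\<And>i. s i > 0" "s 0 = 1"
    using assms by (auto simp: S_def)
  have "(\<epsilon> / P) powr \<epsilon> \<le> 1"
    using P \<epsilon> by (intro powr_le1) auto
  then have "P * (\<epsilon> / P) powr \<epsilon> \<le> P"
    using P by (simp add: mult_left_le)
  also have "P \<le> \<epsilon> * s i"
    using i \<epsilon> by (simp add: field_simps)
  also have "s i \<le> (\<Sum>j<w. s j)"
    using i s by (intro member_le_sum) (auto simp: less_imp_le)
  finally have "P * (\<epsilon> / P) powr \<epsilon> \<le> \<epsilon> * (\<Sum>j<w. s j)"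
    using \<epsilon> by simp
  \<comment> \<open>With \<open>N = 1\<close> only the zeroth term is kept; its denominator is 1
    because \<open>s 0 = 1\<close>.\<close>
  with G_ge_partial_sum[of s \<epsilon> w 1] s \<epsilon> show ?thesis
    by simp (meson ennreal_leI order_trans)
next
  case False
  have s: "\<And>i. s i > 0"
    using assms by (auto simp: S_def)
  have "(\<epsilon> / P) powr \<epsilon> \<le> s i powr - \<epsilon>" if "i < w" for i
  proof -
    have "s i \<le> P / \<epsilon>"
      using False that by (intro leI) blast
    then have "\<epsilon> / P \<le> 1 / s i"
      using \<open>P > 0\<close> \<epsilon> s[of i] by (simp add: field_simps)
    then have "(\<epsilon> / P) powr \<epsilon> \<le> (1 / s i) powr \<epsilon>"
      using P \<epsilon> by (intro powr_mono2) auto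
    then show ?thesis
      using s[of i] by (simp add: powr_minus powr_divide inverse_eq_divide)
  qed
  then have le: "(\<Sum>j<w. r ^ j * (\<Sum>i<j. (\<epsilon> / P) powr \<epsilon>))
      \<le> (\<Sum>j<w. r ^ j * (\<Sum>i<j. s i powr - \<epsilon>))"
    using \<open>r > 1\<close> by (intro sum_mono mult_left_mono) auto
  have "P * (\<epsilon> / P) powr \<epsilon> = (\<Sum>j<w. real j * r ^ j) * (\<epsilon> / P) powr \<epsilon>"
    by (simp only: P(1)[symmetric])
  \<comment> \<open>The inner sum has \<open>j\<close> equal terms, which accounts for the factor
    \<open>real j\<close> in \<open>P\<close>.\<close>
  also have "\<dots> = (\<Sum>j<w. r ^ j * (\<Sum>i<j. (\<epsilon> / P) powr \<epsilon>))"
    by (simp add: sum_distrib_left mult_ac)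
  finally have "ennreal (P * (\<epsilon> / P) powr \<epsilon>) \<le> ennreal (\<Sum>j<w. r ^ j * (\<Sum>i<j. s i powr - \<epsilon>))"
    using le by (simp only: ennreal_leI)
  also have "\<dots> \<le> G w \<epsilon> s"
    using assms(1,2,5) \<epsilon>(1) by (rule G_ge_boundary_sum)
  finally show ?thesis .
qed

theorem theorem4:
  fixes w :: nat
  assumes "w \<ge> 2"
  shows "(SUP \<epsilon>\<in>{0<..}. INF s\<in>S w. G w \<epsilon> s) \<ge> ennreal (C w)"
proof -
  obtain r :: real where r: "r > 1" "(\<Sum>j<w. r ^ j) = ln r * (\<Sum>j<w. real j * r ^ j)"
    using stationary_point_exists[OF assms] .
  note C = C_eq_stationary[OF assms r]
  have pos: "C w > 0"
    unfolding C using assms r by (intro sum_pos2[of _ 1]) auto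
  show ?thesis
  \<comment> \<open>The supremum dominates the bound of \<open>G_ge\<close> for all small
    \<epsilon>, hence also its limit as \<epsilon> decreases to 0.\<close>
  proof (rule tendsto_upperbound)
    have "((\<lambda>\<epsilon>. C w * (\<epsilon> / C w) powr \<epsilon>) \<longlongrightarrow> C w) (at_right 0)"
      using pos by real_asymp
    then show "((\<lambda>\<epsilon>. ennreal (C w * (\<epsilon> / C w) powr \<epsilon>)) \<longlongrightarrow> ennreal (C w)) (at_right 0)"
      by (rule tendsto_ennrealI)
    have "\<forall>\<^sub>F \<epsilon> in at_right 0. \<epsilon> \<in> {0<..<C w}"
      using pos by (rule eventually_at_right_real)
    then show "\<forall>\<^sub>F \<epsilon> in at_right 0. ennreal (C w * (\<epsilon> / C w) powr \<epsilon>)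
        \<le> (SUP \<epsilon>\<in>{0<..}. INF s\<in>S w. G w \<epsilon> s)"
    proof eventually_elim
      case (elim \<epsilon>)
      then have "ennreal (C w * (\<epsilon> / C w) powr \<epsilon>) \<le> (INF s\<in>S w. G w \<epsilon> s)"
        using pos by (intro INF_greatest G_ge[OF r C]) auto
      also have "\<dots> \<le> (SUP \<epsilon>\<in>{0<..}. INF s\<in>S w. G w \<epsilon> s)"
        using elim by (intro SUP_upper) auto
      finally show ?case .
    qed
  qed simp
qed

end
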